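(* Let $X$ be a Banach space with $\operatorname{StrExp}(B_X)\neq\emptyset$ and let $Y$ be a smooth Banach space of dimension at least two (both over $\mathbb{K}$). Then, for every $A\in\mathcal{L}(X,Y)$ there is a smooth operator $T\in\mathcal{L}(X,Y)$ satisfying $T\perp_B A$. Consequently, there are no spear operators in $\mathcal{L}(X,Y)$.
   Context: $\mathbb{K}$ is $\mathbb{R}$ or $\mathbb{C}$. $\mathcal{L}(X,Y)$ is the space of bounded linear operators from $X$ to $Y$ with the operator norm. $\operatorname{StrExp}(B_X)$ is the set of strongly exposed points of the closed unit ball $B_X$: $x_0\in B_X$ belongs to it if there is $f_0\in X^*$, $\|f_0\|=1$, such that whenever $\{x_n\}\subset B_X$ and $\lim\operatorname{Re}f_0(x_n)=1$, then $\lim x_n=x_0$ in norm. A point $z$ of a Banach space $Z$ is smooth if $\{\phi\in Z^*\colon\|\phi\|=1,\ \phi(z)=\|z\|\}$ is a singleton; a Banach space is smooth if all its non-zero points are smooth; a smooth operator is a smooth point of $\mathcal{L}(X,Y)$. $x\perp_B y$ (Birkhoff-James orthogonality) means $\|x+\lambda y\|\geq\|x\|$ for all $\lambda\in\mathbb{K}$. A norm-one element $u$ of a Banach space $Z$ is a spear vector if $\sup\{|\phi(z)|\colon\phi\in Z^*,\ \|\phi\|=1,\ \phi(u)=1\}=\|z\|$ for every $z\in Z$ (equivalently, $\max_{|\theta|=1}\|u+\theta z\|=1+\|z\|$ for every $z\in Z$); a spear operator is a spear vector of $Z=\mathcal{L}(X,Y)$. *)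

theory Defs
  imports "HOL-Analysis.Analysis"
begin

text \<open>The scalar field. A real normed field with an isometric embedding into the complex
  numbers that fixes the reals is \<open>\<real>\<close> or \<open>\<complex>\<close> (lemma \<open>range_to_complex\<close>); both are instances.
  Its elements have a real part, namely \<open>Re (to_complex c)\<close>.\<close>

class real_or_complex = real_normed_field +
  fixes to_complex :: "'a \<Rightarrow> complex"
  assumes to_complex_add: "to_complex (a + b) = to_complex a + to_complex b"
    and to_complex_mult: "to_complex (a * b) = to_complex a * to_complex b"
    and to_complex_scaleR_1: "to_complex (r *\<^sub>R 1) = complex_of_real r"
    and norm_to_complex: "norm (to_complex a) = norm a"

instantiation real :: real_or_complex
begin
definition to_complex_real :: "real \<Rightarrow> complex" where "to_complex_real = complex_of_real"
instance by standard (auto simp: to_complex_real_def)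
end

instantiation complex :: real_or_complex
begin
definition to_complex_complex :: "complex \<Rightarrow> complex" where "to_complex_complex = id"
instance by standard (auto simp: to_complex_complex_def of_real_def)
end

lemma to_complex_of_real: "to_complex (of_real r :: 'a::real_or_complex) = complex_of_real r"
  using to_complex_scaleR_1 [where ?'a = 'a] by (simp add: of_real_def)

lemma inj_to_complex: "inj (to_complex :: 'k::real_or_complex \<Rightarrow> complex)"
proof (rule injI)
  fix a b :: 'k
  assume eq: "to_complex a = to_complex b"
  have "to_complex (a - b) + to_complex b = to_complex a"
    using to_complex_add[of "a - b" b] by simp
  then have "norm (a - b) = 0"
    using eq norm_to_complex[of "a - b"] by simp
  then show "a = b" by simp
qed

lemma range_to_complex:
  "range (to_complex :: 'k::real_or_complex \<Rightarrow> complex) = \<real> \<or>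
   range (to_complex :: 'k \<Rightarrow> complex) = UNIV"
proof (cases "range (to_complex :: 'k \<Rightarrow> complex) \<subseteq> \<real>")
  case True
  have "\<real> \<subseteq> range (to_complex :: 'k \<Rightarrow> complex)"
  proof
    fix z :: complex assume "z \<in> \<real>"
    then obtain r where "z = complex_of_real r" by (auto elim: Reals_cases)
    then show "z \<in> range (to_complex :: 'k \<Rightarrow> complex)"
      by (metis rangeI to_complex_of_real)
  qed
  with True show ?thesis by auto
next
  case False
  then obtain c :: 'k where "to_complex c \<notin> \<real>" by blast
  then have c: "Im (to_complex c) \<noteq> 0" by (simp add: complex_is_Real_iff)
  have "z \<in> range (to_complex :: 'k \<Rightarrow> complex)" for z
  proof -
    define t where "t = Im z / Im (to_complex c)"
    define r where "r = Re z - t * Re (to_complex c)"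
    have "to_complex (of_real r + of_real t * c) = of_real r + of_real t * to_complex c"
      by (simp only: to_complex_add to_complex_mult to_complex_of_real)
    also have "\<dots> = z"
      using c by (simp add: complex_eq_iff r_def t_def)
    finally have "to_complex (of_real r + of_real t * c) = z" .
    then show ?thesis by (metis rangeI)
  qed
  then show ?thesis by auto
qed

text \<open>A normed space over \<open>'k\<close> is a real normed space carrying a scalar multiplication by \<open>'k\<close>
  which extends the real one. It is a Banach space when its type is of class \<open>banach\<close>.\<close>

locale normed_space_over = vector_space s
  for s :: "'k::real_or_complex \<Rightarrow> 'a::real_normed_vector \<Rightarrow> 'a" +
  assumes norm_scale: "norm (s c x) = norm c * norm x"
    and scale_of_real: "s (of_real r) x = r *\<^sub>R x"

text \<open>Notions for the normed space with carrier \<open>Z\<close>, a subspace of an ambient type. The carrier is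
  needed because, for complex scalars, the operators form a proper subspace of the type of bounded
  real-linear maps; otherwise it is \<open>UNIV\<close>. Functionals are made \<open>extensional\<close>, so that equal
  functionals on \<open>Z\<close> are equal as HOL functions.\<close>

definition dual :: "('k::real_or_complex \<Rightarrow> 'z::real_normed_vector \<Rightarrow> 'z) \<Rightarrow> 'z set \<Rightarrow> ('z \<Rightarrow> 'k) set"
  where "dual s Z = {\<phi> \<in> extensional Z.
    (\<forall>x\<in>Z. \<forall>y\<in>Z. \<phi> (x + y) = \<phi> x + \<phi> y) \<and>
    (\<forall>c. \<forall>x\<in>Z. \<phi> (s c x) = c * \<phi> x) \<and>
    (\<exists>C. \<forall>x\<in>Z. norm (\<phi> x) \<le> C * norm x)}"

definition dual_norm :: "'z::real_normed_vector set \<Rightarrow> ('z \<Rightarrow> 'k::real_or_complex) \<Rightarrow> real"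
  where "dual_norm Z \<phi> = (SUP x\<in>Z \<inter> cball 0 1. norm (\<phi> x))"

definition smooth_point ::
    "('k::real_or_complex \<Rightarrow> 'z::real_normed_vector \<Rightarrow> 'z) \<Rightarrow> 'z set \<Rightarrow> 'z \<Rightarrow> bool"
  where "smooth_point s Z z \<longleftrightarrow> z \<in> Z \<and>
    is_singleton {\<phi> \<in> dual s Z. dual_norm Z \<phi> = 1 \<and> \<phi> z = of_real (norm z)}"

definition smooth_space ::
    "('k::real_or_complex \<Rightarrow> 'z::real_normed_vector \<Rightarrow> 'z) \<Rightarrow> 'z set \<Rightarrow> bool"
  where "smooth_space s Z \<longleftrightarrow> (\<forall>z\<in>Z. z \<noteq> 0 \<longrightarrow> smooth_point s Z z)"

definition spear_vector ::
    "('k::real_or_complex \<Rightarrow> 'z::real_normed_vector \<Rightarrow> 'z) \<Rightarrow> 'z set \<Rightarrow> 'z \<Rightarrow> bool"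
  where "spear_vector s Z u \<longleftrightarrow> u \<in> Z \<and> norm u = 1 \<and>
    (\<forall>z\<in>Z. (SUP \<phi>\<in>{\<phi> \<in> dual s Z. dual_norm Z \<phi> = 1 \<and> \<phi> u = 1}. norm (\<phi> z)) = norm z)"

definition bj_orthogonal ::
    "('k::real_or_complex \<Rightarrow> 'z::real_normed_vector \<Rightarrow> 'z) \<Rightarrow> 'z \<Rightarrow> 'z \<Rightarrow> bool"
  where "bj_orthogonal s x y \<longleftrightarrow> (\<forall>c. norm (x + s c y) \<ge> norm x)"

definition strongly_exposed_points ::
    "('k::real_or_complex \<Rightarrow> 'a::real_normed_vector \<Rightarrow> 'a) \<Rightarrow> 'a set"
  where "strongly_exposed_points s = {x\<^sub>0 \<in> cball 0 1.
    \<exists>f \<in> dual s UNIV. dual_norm UNIV f = 1 \<and>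
      (\<forall>x :: nat \<Rightarrow> 'a. range x \<subseteq> cball 0 1 \<longrightarrow>
        (\<lambda>n. Re (to_complex (f (x n)))) \<longlonglongrightarrow> 1 \<longrightarrow> x \<longlonglongrightarrow> x\<^sub>0)}"

text \<open>The space of bounded \<open>'k\<close>-linear operators, inside the type of bounded real-linear maps, whose
  norm is the operator norm; \<open>scale_op\<close> is its pointwise scalar multiplication.\<close>

definition operators ::
    "('k::real_or_complex \<Rightarrow> 'a::real_normed_vector \<Rightarrow> 'a) \<Rightarrow>
     ('k \<Rightarrow> 'b::real_normed_vector \<Rightarrow> 'b) \<Rightarrow> ('a \<Rightarrow>\<^sub>L 'b) set"
  where "operators sX sY = {T. Vector_Spaces.linear sX sY (blinfun_apply T)}"

definition scale_op ::
    "('k::real_or_complex \<Rightarrow> 'b::real_normed_vector \<Rightarrow> 'b) \<Rightarrow> 'k \<Rightarrow>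
     ('a::real_normed_vector \<Rightarrow>\<^sub>L 'b) \<Rightarrow> ('a \<Rightarrow>\<^sub>L 'b)"
  where "scale_op sY c T = Blinfun (\<lambda>x. sY c (T x))"

lemma scale_op_apply:
  assumes "normed_space_over sY"
  shows "blinfun_apply (scale_op sY c T) x = sY c (T x)"
proof -
  interpret normed_space_over sY by fact
  have "bounded_linear (sY c)"
  proof (rule bounded_linear_intro[where K = "norm c"])
    show "sY c (x + y) = sY c x + sY c y" for x y by (rule scale_right_distrib)
    show "sY c (r *\<^sub>R x) = r *\<^sub>R sY c x" for r x
      by (metis scale_of_real scale_left_commute)
    show "norm (sY c x) \<le> norm x * norm c" for x by (simp add: norm_scale)
  qed
  then have "bounded_linear (\<lambda>x. sY c (T x))"
    by (rule bounded_linear_compose) (rule blinfun.bounded_linear_right)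
  then show ?thesis by (simp add: scale_op_def bounded_linear_Blinfun_apply)
qed

lemma normed_space_over_scale_op:
  assumes "normed_space_over sY"
  shows "normed_space_over (scale_op sY :: 'k::real_or_complex \<Rightarrow>
    ('a::real_normed_vector \<Rightarrow>\<^sub>L 'b::real_normed_vector) \<Rightarrow> _)"
proof -
  interpret normed_space_over sY by fact
  note app = scale_op_apply[OF assms]
  have le: "norm (scale_op sY c T) \<le> norm c * norm T" for c and T :: "'a \<Rightarrow>\<^sub>L 'b"
    by (rule norm_blinfun_bound)
      (auto simp: app norm_scale mult.assoc intro!: mult_left_mono norm_blinfun)
  have ge: "norm c * norm T \<le> norm (scale_op sY c T)" for c and T :: "'a \<Rightarrow>\<^sub>L 'b"
  proof (cases "c = 0")
    case False
    have "T = scale_op sY (inverse c) (scale_op sY c T)"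
      by (rule blinfun_eqI) (use False in \<open>simp add: app\<close>)
    then have "norm T \<le> norm (inverse c) * norm (scale_op sY c T)"
      by (metis le)
    with False show ?thesis by (simp add: norm_divide field_simps)
  qed simp
  show ?thesis
    by unfold_locales
      (auto intro!: blinfun_eqI antisym[OF le ge]
        simp: app blinfun.add_left blinfun.scaleR_left scale_of_real
          scale_right_distrib scale_left_distrib)
qed

lemma subspace_operators:
  assumes "normed_space_over sX" "normed_space_over sY"
  shows "module.subspace (scale_op sY) (operators sX sY)"
proof -
  interpret X: normed_space_over sX by fact
  interpret Y: normed_space_over sY by fact
  interpret L: normed_space_over "scale_op sY" by (rule normed_space_over_scale_op) fact
  have lin: "T \<in> operators sX sY \<longleftrightarrow> (\<forall>c x. T (sX c x) = sY c (T x))" for T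
    by (auto simp: operators_def Vector_Spaces.linear_iff blinfun.add_right
        X.vector_space_axioms Y.vector_space_axioms)
  show ?thesis
    by (auto simp: L.subspace_def lin scale_op_apply[OF assms(2)]
        blinfun.add_left Y.scale_right_distrib Y.scale_left_commute)
qed

abbreviation smooth_operator where
  "smooth_operator sX sY \<equiv> smooth_point (scale_op sY) (operators sX sY)"

abbreviation spear_operator where
  "spear_operator sX sY \<equiv> spear_vector (scale_op sY) (operators sX sY)"

end

theory Submission imports Defs begin

text \<open>If \<open>f\<close> strongly exposes \<open>x\<^sub>0\<close> and \<open>y\<close> is a smooth unit vector, then the rank-one operator
  \<open>x \<mapsto> f x y\<close> is smooth: its only support functional is \<open>S \<mapsto> \<psi> (S x\<^sub>0)\<close>, where \<open>\<psi>\<close> supports \<open>y\<close>.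
  It is orthogonal to \<open>A\<close> as soon as \<open>y\<close> is orthogonal to \<open>A x\<^sub>0\<close>, and such a \<open>y\<close> is the difference
  between a vector off the line spanned by \<open>A x\<^sub>0\<close> and a nearest point of that line. For a spear
  \<open>U\<close>, compactness yields support functionals of \<open>U\<close> that are unimodular on each of these rank-one
  operators; this makes the support functional at \<open>U x\<^sub>0\<close> unimodular on the unit sphere of \<open>Y\<close>,
  but it has a nontrivial kernel.\<close>

section \<open>Compactness in the scalar field and of sets of support functionals\<close>

text \<open>The map \<open>to_complex\<close> is an isometry with closed range, so the disc is the
  isometric image of a closed part of a compact complex disc. This serves nearest points on a line
  as well as the product of discs below.\<close>

lemma compact_cball_scalar: "compact (cball (0::'k::real_or_complex) r)"
proof -
  let ?g = "inv (to_complex :: 'k \<Rightarrow> complex)"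
  let ?D = "range (to_complex :: 'k \<Rightarrow> complex) \<inter> cball 0 r"
  have dist: "dist (to_complex a) (to_complex b) = dist a b" for a b :: 'k
    using to_complex_add[of "a - b" b] norm_to_complex[of "a - b"] by (simp add: dist_norm)
  have "closed (range (to_complex :: 'k \<Rightarrow> complex))"
    using range_to_complex[where 'k = 'k] by (auto simp: closed_complex_Reals)
  then have "compact ?D"
    by (simp add: closed_Int_compact)
  moreover have "continuous_on ?D ?g"
    unfolding continuous_on_iff
    by (auto simp: inv_f_f[OF inj_to_complex] dist)
  ultimately have "compact (?g ` ?D)"
    by (rule compact_continuous_image[rotated])
  moreover have "?g ` ?D = cball 0 r"
  proof safe
    fix c :: 'k assume "to_complex c \<in> cball 0 r"
    then show "?g (to_complex c) \<in> cball 0 r"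
      by (simp add: inv_f_f[OF inj_to_complex] norm_to_complex)
  next
    fix c :: 'k assume "c \<in> cball 0 r"
    then show "c \<in> ?g ` ?D"
      by (intro image_eqI[of _ _ "to_complex c"])
        (auto simp: inv_f_f[OF inj_to_complex] norm_to_complex)
  qed
  ultimately show ?thesis by simp
qed

text \<open>For a unit vector this is the face of the dual unit ball exposed by \<open>z\<close>.
  \<open>smooth_point\<close> asks that it be a singleton, and \<open>spear_vector\<close> takes its
  suprema over it.\<close>

definition support_functionals ::
    "('k::real_or_complex \<Rightarrow> 'z::real_normed_vector \<Rightarrow> 'z) \<Rightarrow> 'z set \<Rightarrow> 'z \<Rightarrow> ('z \<Rightarrow> 'k) set"
  where "support_functionals s Z z =
    {\<phi> \<in> dual s Z. dual_norm Z \<phi> = 1 \<and> \<phi> z = of_real (norm z)}"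

context normed_space_over
begin

lemma norm_dual_le:
  assumes Z: "subspace Z" and \<phi>: "\<phi> \<in> dual s Z" and z: "z \<in> Z"
  shows "norm (\<phi> z) \<le> dual_norm Z \<phi> * norm z"
proof (cases "z = 0")
  case True
  have "\<phi> (s 0 z) = 0 * \<phi> z"
    using \<phi> z unfolding dual_def by blast
  with True show ?thesis by simp
next
  case False
  obtain C where C: "\<And>x. x \<in> Z \<Longrightarrow> norm (\<phi> x) \<le> C * norm x"
    using \<phi> unfolding dual_def by blast
  have "norm (\<phi> x) \<le> \<bar>C\<bar>" if "x \<in> Z \<inter> cball 0 1" for x
  proof -
    have "norm (\<phi> x) \<le> C * norm x" using C that by blast
    also have "\<dots> \<le> \<bar>C\<bar> * norm x" by (intro mult_right_mono) auto
    also have "\<dots> \<le> \<bar>C\<bar> * 1" using that by (intro mult_left_mono) auto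
    finally show ?thesis by simp
  qed
  then have bdd: "bdd_above ((\<lambda>x. norm (\<phi> x)) ` (Z \<inter> cball 0 1))"
    by (intro bdd_aboveI2)
  let ?c = "of_real (inverse (norm z)) :: 'k"
  have "s ?c z \<in> Z \<inter> cball 0 1"
    using Z z False by (auto simp: subspace_def norm_scale norm_inverse)
  then have "norm (\<phi> (s ?c z)) \<le> dual_norm Z \<phi>"
    unfolding dual_norm_def using bdd by (rule cSUP_upper)
  moreover have "\<phi> (s ?c z) = ?c * \<phi> z"
    using \<phi> z unfolding dual_def by blast
  ultimately have "inverse (norm z) * norm (\<phi> z) \<le> dual_norm Z \<phi>"
    by (simp add: norm_mult norm_inverse)
  with False show ?thesis by (simp add: field_simps)
qed

text \<open>The bound by \<open>norm x\<close> makes the supremum in \<open>dual_norm\<close> at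
  most 1, and the value at \<open>u\<close> attains it. Every condition on the right is pointwise,
  hence closed in the product topology.\<close>

lemma support_functionals_iff:
  assumes Z: "subspace Z" and u: "u \<in> Z" "norm u = 1"
  shows "\<phi> \<in> support_functionals s Z u \<longleftrightarrow> \<phi> \<in> extensional Z \<and>
    (\<forall>x\<in>Z. \<forall>y\<in>Z. \<phi> (x + y) = \<phi> x + \<phi> y) \<and>
    (\<forall>c. \<forall>x\<in>Z. \<phi> (s c x) = c * \<phi> x) \<and>
    (\<forall>x\<in>Z. norm (\<phi> x) \<le> norm x) \<and> \<phi> u = 1" (is "_ \<longleftrightarrow> ?R")
proof
  assume *: "\<phi> \<in> support_functionals s Z u"
  then have "norm (\<phi> x) \<le> norm x" if "x \<in> Z" for x
    using norm_dual_le[OF Z _ that, of \<phi>] by (simp add: support_functionals_def)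
  with * u show ?R by (auto simp: support_functionals_def dual_def)
next
  assume R: ?R
  then have "\<phi> \<in> dual s Z"
    unfolding dual_def by (auto intro!: exI[of _ 1])
  moreover have "dual_norm Z \<phi> = 1"
    unfolding dual_norm_def
  proof (rule cSup_eq_maximum)
    show "1 \<in> (\<lambda>x. norm (\<phi> x)) ` (Z \<inter> cball 0 1)"
      using R u by (intro image_eqI[of _ _ u]) auto
    show "y \<le> 1" if "y \<in> (\<lambda>x. norm (\<phi> x)) ` (Z \<inter> cball 0 1)" for y
      using R that by force
  qed
  ultimately show "\<phi> \<in> support_functionals s Z u"
    using R u by (simp add: support_functionals_def)
qed

text \<open>Division by a unimodular number preserves linearity and the norm bound and turns the
  value at \<open>z\<close> into 1. This moves a functional from \<open>u\<close> to
  \<open>z\<close> without changing any modulus.\<close>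

lemma support_functionals_rescale:
  assumes Z: "subspace Z" and u: "u \<in> Z" "norm u = 1" and z: "z \<in> Z" "norm z = 1"
    and \<phi>: "\<phi> \<in> support_functionals s Z u" and 1: "norm (\<phi> z) = 1"
  shows "(\<lambda>x\<in>Z. \<phi> x / \<phi> z) \<in> support_functionals s Z z"
proof -
  have "\<phi> z \<noteq> 0" using 1 by auto
  moreover have "x + y \<in> Z" "s c x \<in> Z" if "x \<in> Z" "y \<in> Z" for x y c
    using Z that by (auto simp: subspace_def)
  ultimately show ?thesis
    using \<phi> 1 z unfolding support_functionals_iff[OF Z u] support_functionals_iff[OF Z z]
    by (simp add: norm_divide add_divide_distrib)
qed

text \<open>The Banach--Alaoglu argument: the support functionals are closed in a product of discs.\<close>

lemma compact_support_functionals: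
  assumes Z: "subspace Z" and u: "u \<in> Z" "norm u = 1"
  shows "compact (support_functionals s Z u)"
proof -
  \<comment> \<open>The singleton factors outside \<open>Z\<close> encode extensionality and are
    compact too.\<close>
  let ?P = "PiE UNIV (\<lambda>x. if x \<in> Z then cball (0::'k) (norm x) else {undefined})"
  have "compactin (product_topology (\<lambda>_::'a. euclidean :: 'k topology) UNIV) ?P"
    by (simp add: compactin_PiE compact_cball_scalar)
  then have P: "compact ?P"
    by (simp add: euclidean_product_topology)
  have cont: "continuous_on UNIV (\<lambda>\<phi>::'a \<Rightarrow> 'k. \<phi> x)" for x
    by (rule continuous_on_product_coordinates)
  have "closed ((\<Inter>x\<in>Z. \<Inter>y\<in>Z. {\<phi>::'a \<Rightarrow> 'k. \<phi> (x + y) = \<phi> x + \<phi> y}) \<inter>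
      (\<Inter>c. \<Inter>x\<in>Z. {\<phi>. \<phi> (s c x) = c * \<phi> x}) \<inter> {\<phi>. \<phi> u = 1})" (is "closed ?C")
    by (intro closed_Int closed_INT ballI closed_Collect_eq continuous_intros cont)
  with P have "compact (?P \<inter> ?C)" by (rule compact_Int_closed)
  moreover have "?P \<inter> ?C = support_functionals s Z u"
  proof (rule set_eqI)
    fix \<phi> :: "'a \<Rightarrow> 'k"
    have "\<phi> x \<in> (if x \<in> Z then cball 0 (norm x) else {undefined}) \<longleftrightarrow>
        (x \<in> Z \<longrightarrow> norm (\<phi> x) \<le> norm x) \<and> (x \<notin> Z \<longrightarrow> \<phi> x = undefined)" for x
      by simp
    then have "\<phi> \<in> ?P \<longleftrightarrow> (\<forall>x\<in>Z. norm (\<phi> x) \<le> norm x) \<and> \<phi> \<in> extensional Z"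
      unfolding PiE_UNIV_domain Pi_iff extensional_def mem_Collect_eq by blast
    then show "\<phi> \<in> ?P \<inter> ?C \<longleftrightarrow> \<phi> \<in> support_functionals s Z u"
      unfolding support_functionals_iff[OF Z u] Int_iff INT_iff mem_Collect_eq by blast
  qed
  ultimately show ?thesis by simp
qed

text \<open>Evaluation at \<open>z\<close> is continuous on a compact set of functionals, so the
  supremum in the definition of a spear is a maximum.\<close>

lemma spear_vector_attained:
  assumes Z: "subspace Z" and spear: "spear_vector s Z u" and z: "z \<in> Z"
  obtains \<phi> where "\<phi> \<in> support_functionals s Z u" "norm (\<phi> z) = norm z"
proof -
  have u: "u \<in> Z" "norm u = 1"
    using spear by (auto simp: spear_vector_def)
  let ?F = "support_functionals s Z u"
  have F: "?F = {\<phi> \<in> dual s Z. dual_norm Z \<phi> = 1 \<and> \<phi> u = 1}"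
    using u by (simp add: support_functionals_def)
  have sup: "(SUP \<phi>\<in>?F. norm (\<phi> x)) = norm x" if "x \<in> Z" for x
    using spear that by (simp add: spear_vector_def F)
  \<comment> \<open>Over an empty set the suprema for \<open>u\<close> and for 0 would coincide, but
    they are 1 and 0.\<close>
  have "?F \<noteq> {}"
    using sup[of u] sup[of 0] u subspace_0[OF Z] by force
  moreover have "continuous_on ?F (\<lambda>\<phi>. norm (\<phi> z))"
    by (intro continuous_on_norm continuous_on_subset[OF continuous_on_product_coordinates]) simp
  ultimately obtain \<phi> where \<phi>: "\<phi> \<in> ?F" "\<And>\<psi>. \<psi> \<in> ?F \<Longrightarrow> norm (\<psi> z) \<le> norm (\<phi> z)"
    using continuous_attains_sup[OF compact_support_functionals[OF Z u]] by metis
  have "(SUP \<psi>\<in>?F. norm (\<psi> z)) = norm (\<phi> z)"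
    by (rule cSup_eq_maximum) (use \<phi> in auto)
  then show ?thesis using that \<phi> sup[OF z] by simp
qed

lemma smooth_pointE:
  assumes "smooth_point s Z z"
  obtains \<phi> where "support_functionals s Z z = {\<phi>}"
  using assms unfolding smooth_point_def support_functionals_def[symmetric] is_singleton_def
  by blast

section \<open>Vectors off a line and Birkhoff-James orthogonality\<close>

lemma ex_not_multiple:
  assumes "card B = 2" "\<not> dependent B"
  obtains v where "\<And>c. v \<noteq> s c w"
proof -
  have "\<not> B \<subseteq> span {w}"
    using independent_span_bound[of "{w}" B] assms by auto
  then show ?thesis
    using that by (auto simp: span_singleton)
qed

lemma norm_normalize: "y \<noteq> 0 \<Longrightarrow> norm (s (of_real (inverse (norm y))) y) = 1"
  by (simp add: norm_scale norm_inverse)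

text \<open>A minimizer of the distance from \<open>v\<close> to the line of \<open>w\<close> exists
  by compactness of a disc of coefficients. The resulting difference is orthogonal to
  \<open>w\<close> and nonzero, since \<open>v\<close> lies off the line.\<close>

lemma ex_bj_orthogonal:
  assumes v: "\<And>c. v \<noteq> s c w"
  obtains y where "norm y = 1" "bj_orthogonal s y w"
proof -
  let ?f = "\<lambda>c. norm (v + s c w)"
  have lip: "norm (s c w - s d w) = norm (c - d) * norm w" for c d
    by (metis norm_scale scale_left_diff_distrib)
  have "(norm w)-lipschitz_on UNIV (\<lambda>c. s c w)"
    by (rule lipschitz_onI) (auto simp: dist_norm lip mult.commute)
  then have cont: "continuous_on S ?f" for S
    by (intro continuous_intros) (blast intro: lipschitz_on_continuous_on continuous_on_subset)
  obtain c where c: "\<And>d. ?f c \<le> ?f d"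
  proof (cases "w = 0")
    case True
    then show ?thesis using that by simp
  next
    case False
    \<comment> \<open>Beyond this radius \<open>s d w\<close> is longer than twice \<open>v\<close>,
      so \<open>?f d\<close> is at least \<open>norm v\<close>, the value at coefficient 0.\<close>
    define r where "r = 2 * norm v / norm w"
    have "0 \<le> r" by (simp add: r_def)
    then have "cball (0::'k) r \<noteq> {}" by simp
    then obtain c where c: "c \<in> cball 0 r" "\<And>d. d \<in> cball 0 r \<Longrightarrow> ?f c \<le> ?f d"
      using continuous_attains_inf[OF compact_cball_scalar _ cont] by metis
    have "?f c \<le> ?f d" for d
    proof (cases "d \<in> cball 0 r")
      case False
      then have "2 * norm v < norm d * norm w"
        using \<open>w \<noteq> 0\<close> by (simp add: r_def not_le divide_less_eq)
      then have "norm v \<le> ?f d"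
        using norm_diff_ineq[of "s d w" v] by (simp add: norm_scale add.commute)
      moreover have "?f c \<le> ?f 0"
        using \<open>0 \<le> r\<close> by (intro c) simp
      ultimately show ?thesis by simp
    qed (use c in blast)
    then show ?thesis using that by blast
  qed
  let ?y = "v + s c w" and ?r = "of_real (inverse (norm (v + s c w))) :: 'k"
  have "?y \<noteq> 0"
    using v[of "- c"] by (simp add: eq_neg_iff_add_eq_0)
  then have r: "norm (s ?r ?y) = 1" "?r \<noteq> 0"
    by (rule norm_normalize) (use \<open>?y \<noteq> 0\<close> in simp)
  have "norm (s ?r ?y) \<le> norm (s ?r ?y + s d w)" for d
  proof -
    \<comment> \<open>Up to the factor \<open>?r\<close>, the perturbed vector is another competitor
      in the minimization.\<close>
    have "s ?r ?y + s d w = s ?r (v + s (c + d / ?r) w)"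
      using r(2) by (simp add: scale_right_distrib scale_left_distrib add.assoc)
    then show ?thesis
      using c[of "c + d / ?r"] by (simp add: norm_scale mult_left_mono)
  qed
  then show ?thesis
    using that r by (auto simp: bj_orthogonal_def)
qed

section \<open>Strong exposure in epsilon-delta form\<close>

text \<open>Operator norms involve the modulus of \<open>f x\<close>, whereas exposure is defined
  through its real part. Rotating \<open>x\<close> by the phase of \<open>f x\<close> makes the two
  agree, at the cost of a unimodular factor on the exposed point.\<close>

lemma strongly_exposedE:
  assumes "x\<^sub>0 \<in> strongly_exposed_points s"
  obtains f where "norm x\<^sub>0 = 1" "f \<in> support_functionals s UNIV x\<^sub>0"
    "\<And>e. e > 0 \<Longrightarrow> \<exists>d>0. \<forall>x. norm x \<le> 1 \<and> norm (f x) > 1 - d \<longrightarrow>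
      (\<exists>c. norm c = 1 \<and> norm (x - s c x\<^sub>0) < e)"
proof -
  obtain f where x0: "norm x\<^sub>0 \<le> 1" and f: "f \<in> dual s UNIV" "dual_norm UNIV f = 1"
    and lim: "\<And>x :: nat \<Rightarrow> 'a. range x \<subseteq> cball 0 1 \<Longrightarrow>
      (\<lambda>n. Re (to_complex (f (x n)))) \<longlonglongrightarrow> 1 \<Longrightarrow> x \<longlonglongrightarrow> x\<^sub>0"
    using assms unfolding strongly_exposed_points_def by auto
  have add: "f (x + y) = f x + f y" and scale: "f (s c x) = c * f x" for x y c
    using f(1) unfolding dual_def by blast+
  have le: "norm (f x) \<le> norm x" for x
    using norm_dual_le[OF subspace_UNIV f(1), of x] f(2) by simp
  have diff: "f (x - y) = f x - f y" for x y
    using add[of "x - y" y] by simp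
  have Re_le: "Re (to_complex (f x)) \<le> 1" if "norm x \<le> 1" for x
    using complex_Re_le_cmod[of "to_complex (f x)"] le[of x] that by (simp add: norm_to_complex)
  have near: "\<exists>d>0. \<forall>x. norm x \<le> 1 \<and> Re (to_complex (f x)) > 1 - d \<longrightarrow> norm (x - x\<^sub>0) < e"
    if e: "e > 0" for e
  proof (rule ccontr)
    assume "\<not> ?thesis"
    then have "\<exists>x. norm x \<le> 1 \<and> Re (to_complex (f x)) > 1 - inverse (real (Suc n)) \<and>
        norm (x - x\<^sub>0) \<ge> e" for n
      by (metis inverse_positive_iff_positive not_le of_nat_0_less_iff zero_less_Suc)
    then obtain x where x: "\<And>n. norm (x n) \<le> 1"
      "\<And>n. Re (to_complex (f (x n))) > 1 - inverse (real (Suc n))"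
      "\<And>n. norm (x n - x\<^sub>0) \<ge> e"
      by metis
    have "(\<lambda>n. Re (to_complex (f (x n)))) \<longlonglongrightarrow> 1"
    proof (rule tendsto_sandwich)
      show "(\<lambda>n. 1 - inverse (real (Suc n))) \<longlonglongrightarrow> 1"
        using tendsto_diff[OF tendsto_const LIMSEQ_inverse_real_of_nat, of 1] by simp
      show "(\<lambda>n. 1) \<longlonglongrightarrow> (1::real)" by simp
      show "\<forall>\<^sub>F n in sequentially. 1 - inverse (real (Suc n)) \<le> Re (to_complex (f (x n)))"
        using x(2) by (intro always_eventually allI less_imp_le)
      show "\<forall>\<^sub>F n in sequentially. Re (to_complex (f (x n))) \<le> 1"
        using x(1) Re_le by simp
    qed
    then have "x \<longlonglongrightarrow> x\<^sub>0"
      using x by (intro lim) auto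
    then obtain n where "norm (x n - x\<^sub>0) < e"
      using e by (meson LIMSEQ_D order_refl)
    with x(3) show False by (meson not_le)
  qed
  have main: "\<exists>d>0. \<forall>x. norm x \<le> 1 \<and> norm (f x) > 1 - d \<longrightarrow>
      (\<exists>c. norm c = 1 \<and> f x = c * of_real (norm (f x)) \<and> norm (x - s c x\<^sub>0) < e)"
    if e: "e > 0" for e
  proof -
    obtain d where d: "d > 0"
      "\<And>x. norm x \<le> 1 \<Longrightarrow> Re (to_complex (f x)) > 1 - d \<Longrightarrow> norm (x - x\<^sub>0) < e"
      using near[OF e] by blast
    have "\<exists>c. norm c = 1 \<and> f x = c * of_real (norm (f x)) \<and> norm (x - s c x\<^sub>0) < e"
      \<comment> \<open>The cap at 1 keeps \<open>f x\<close> nonzero, so that its phase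
        \<open>c\<close> exists.\<close>
      if x: "norm x \<le> 1" "norm (f x) > 1 - min d 1" for x
    proof -
      have nz: "f x \<noteq> 0" using x by auto
      define c where "c = f x / of_real (norm (f x))"
      have c: "norm c = 1" "f x = c * of_real (norm (f x))" "c \<noteq> 0"
        using nz by (auto simp: c_def norm_divide)
      have "f (s (inverse c) x) = of_real (norm (f x))"
        unfolding scale by (subst c(2)) (use c(3) in simp)
      then have "norm (s (inverse c) x - x\<^sub>0) < e"
        using x c by (intro d) (auto simp: norm_scale norm_inverse to_complex_of_real)
      moreover have "s c (s (inverse c) x - x\<^sub>0) = x - s c x\<^sub>0"
        using c(3) by (simp add: scale_right_diff_distrib)
      ultimately show ?thesis
        using c norm_scale[of c "s (inverse c) x - x\<^sub>0"] by (intro exI[of _ c]) simp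
    qed
    with d(1) show ?thesis by (intro exI[of _ "min d 1"]) auto
  qed
  \<comment> \<open>Since \<open>f\<close> has dual norm 1, some \<open>x\<close> in the ball nearly
    attains it. This \<open>x\<close> is close to a rotation of the exposed point, so the value of
    \<open>f\<close> there is close to 1.\<close>
  have "norm (f x\<^sub>0 - 1) \<le> 0 + e" if e: "e > 0" for e
  proof -
    obtain d where d: "d > 0" "\<And>x. norm x \<le> 1 \<Longrightarrow> norm (f x) > 1 - d \<Longrightarrow>
      \<exists>c. norm c = 1 \<and> f x = c * of_real (norm (f x)) \<and> norm (x - s c x\<^sub>0) < e / 2"
      using main[of "e / 2"] e by auto
    have "1 - min d (e / 2) < (SUP x\<in>UNIV \<inter> cball 0 1. norm (f x))"
      using f(2) d(1) e by (simp add: dual_norm_def)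
    then obtain x where x: "norm x \<le> 1" "1 - min d (e / 2) < norm (f x)"
      by (elim less_cSupE) auto
    then obtain c where c: "norm c = 1" "f x = c * of_real (norm (f x))" "norm (x - s c x\<^sub>0) < e / 2"
      using d(2)[of x] by (metis diff_left_mono le_less_trans min.cobounded1)
    have "norm (c * (f x\<^sub>0 - 1)) = norm ((f x - c) - f (x - s c x\<^sub>0))"
      by (simp add: diff scale algebra_simps)
    also have "\<dots> \<le> norm (f x - c) + norm (x - s c x\<^sub>0)"
      using norm_triangle_ineq4[of "f x - c" "f (x - s c x\<^sub>0)"] le[of "x - s c x\<^sub>0"] by linarith
    also have "f x - c = c * of_real (norm (f x) - 1)"
      using c(2) by (simp add: algebra_simps)
    also have "norm \<dots> \<le> e / 2"
      using x le[of x] c(1) by (simp add: norm_mult del: of_real_diff)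
    finally show ?thesis using c by (simp add: norm_mult)
  qed
  then have fx0: "f x\<^sub>0 = 1"
    using field_le_epsilon[of "norm (f x\<^sub>0 - 1)" 0] by auto
  have 1: "norm x\<^sub>0 = 1"
    using le[of x\<^sub>0] x0 fx0 by simp
  show ?thesis
  proof (rule that[OF 1])
    show "f \<in> support_functionals s UNIV x\<^sub>0"
      using f 1 fx0 by (simp add: support_functionals_def)
  qed (use main in meson)
qed

end

section \<open>Rank-one operators and their support functionals\<close>

lemma norm_blinfun_le_unit:
  fixes T :: "'a::real_normed_vector \<Rightarrow>\<^sub>L 'b::real_normed_vector"
  assumes "0 \<le> b" and le: "\<And>x. norm x \<le> 1 \<Longrightarrow> norm (T x) \<le> b"
  shows "norm T \<le> b"
proof (rule norm_blinfun_bound[OF \<open>0 \<le> b\<close>])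
  fix x
  show "norm (T x) \<le> b * norm x"
  proof (cases "x = 0")
    case False
    then show ?thesis
      using le[of "inverse (norm x) *\<^sub>R x"] by (simp add: blinfun.scaleR_right field_simps)
  qed simp
qed

locale strongly_exposed_operators = X: normed_space_over sX + Y: normed_space_over sY
  for sX :: "'k::real_or_complex \<Rightarrow> 'a::real_normed_vector \<Rightarrow> 'a"
    and sY :: "'k \<Rightarrow> 'b::real_normed_vector \<Rightarrow> 'b" +
  fixes x\<^sub>0 f
  assumes norm_x0: "norm x\<^sub>0 = 1"
    and f: "f \<in> support_functionals sX UNIV x\<^sub>0"
    and exposing: "\<And>e. e > 0 \<Longrightarrow> \<exists>d>0. \<forall>x. norm x \<le> 1 \<and> norm (f x) > 1 - d \<longrightarrow>
      (\<exists>c. norm c = 1 \<and> norm (x - sX c x\<^sub>0) < e)"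
begin

sublocale L: normed_space_over "scale_op sY :: 'k \<Rightarrow> ('a \<Rightarrow>\<^sub>L 'b) \<Rightarrow> _"
  by (rule normed_space_over_scale_op) (rule Y.normed_space_over_axioms)

abbreviation "Ops \<equiv> operators sX sY"

lemmas subspace_Ops = subspace_operators[OF X.normed_space_over_axioms Y.normed_space_over_axioms]
lemmas scale_op_apply' [simp] = scale_op_apply[OF Y.normed_space_over_axioms]

lemma f_simps [simp]: "f (x + y) = f x + f y" "f (sX c x) = c * f x" "f x\<^sub>0 = 1"
  and norm_f_le: "norm (f x) \<le> norm x"
  using f by (auto simp: X.support_functionals_iff norm_x0)

lemma Ops_iff: "T \<in> Ops \<longleftrightarrow> (\<forall>c x. T (sX c x) = sY c (T x))"
  by (auto simp: operators_def Vector_Spaces.linear_iff blinfun.add_right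
    X.vector_space_axioms Y.vector_space_axioms)

definition rank_one :: "'b \<Rightarrow> 'a \<Rightarrow>\<^sub>L 'b"
  where "rank_one y = Blinfun (\<lambda>x. sY (f x) y)"

lemma rank_one_apply [simp]: "rank_one y x = sY (f x) y"
proof -
  have "bounded_linear (\<lambda>x. sY (f x) y)"
  proof (rule bounded_linear_intro[where K = "norm y"])
    show "sY (f (r *\<^sub>R x)) y = r *\<^sub>R sY (f x) y" for r x
      by (metis X.scale_of_real Y.scale_of_real Y.scale_scale f_simps(2))
    show "norm (sY (f x) y) \<le> norm x * norm y" for x
      by (simp add: Y.norm_scale norm_f_le mult_right_mono)
  qed (simp add: Y.scale_left_distrib)
  then show ?thesis
    by (simp add: rank_one_def bounded_linear_Blinfun_apply)
qed

lemma rank_one_Ops [simp]: "rank_one y \<in> Ops"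
  by (simp add: Ops_iff)

lemma norm_apply_x0: "norm (T x\<^sub>0) \<le> norm T" for T :: "'a \<Rightarrow>\<^sub>L 'b"
  using norm_blinfun[of T x\<^sub>0] by (simp add: norm_x0)

lemma norm_rank_one [simp]: "norm (rank_one y) = norm y"
proof (rule antisym)
  show "norm (rank_one y) \<le> norm y"
    by (rule norm_blinfun_bound)
      (auto simp: Y.norm_scale norm_f_le mult.commute[of "norm y"] mult_right_mono)
  show "norm y \<le> norm (rank_one y)"
    using norm_apply_x0[of "rank_one y"] by simp
qed

lemma rank_one_add: "rank_one (v + w) = rank_one v + rank_one w"
  by (rule blinfun_eqI) (simp add: Y.scale_right_distrib blinfun.add_left)

lemma rank_one_scale: "rank_one (sY c v) = scale_op sY c (rank_one v)"
  by (rule blinfun_eqI) (simp add: mult.commute)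

text \<open>Near points where \<open>rank_one y\<close> almost attains its norm, \<open>S\<close> is small because it vanishes
  at \<open>x\<^sub>0\<close>; elsewhere there is room for a perturbation. Hence
  \<open>norm (rank_one y + t *\<^sub>R S) \<le> 1 + o(t)\<close>.\<close>

lemma support_functional_vanishes:
  assumes y: "norm y = 1" and \<phi>: "\<phi> \<in> support_functionals (scale_op sY) Ops (rank_one y)"
    and S: "S \<in> Ops" "S x\<^sub>0 = 0"
  shows "\<phi> S = 0"
proof (rule ccontr)
  assume nz: "\<phi> S \<noteq> 0"
  have \<phi>_add: "\<And>T U. T \<in> Ops \<Longrightarrow> U \<in> Ops \<Longrightarrow> \<phi> (T + U) = \<phi> T + \<phi> U"
    and \<phi>_scale: "\<And>c T. T \<in> Ops \<Longrightarrow> \<phi> (scale_op sY c T) = c * \<phi> T"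
    and \<phi>_le: "\<And>T. T \<in> Ops \<Longrightarrow> norm (\<phi> T) \<le> norm T"
    and \<phi>_1: "\<phi> (rank_one y) = 1"
    using \<phi> y by (simp_all add: L.support_functionals_iff[OF subspace_Ops])
  \<comment> \<open>With this normalization the functional takes the value \<open>1 + t\<close> at
    \<open>?T\<close> below, against the norm bound \<open>1 + t / 2\<close>.\<close>
  define R where "R = scale_op sY (inverse (\<phi> S)) S"
  have R: "R \<in> Ops" "R x\<^sub>0 = 0" "\<phi> R = 1"
    using S nz subspace_Ops by (auto simp: R_def \<phi>_scale L.subspace_def)
  \<comment> \<open>This radius makes \<open>norm R * ?e\<close> at most one half.\<close>
  let ?e = "1 / (2 * (norm R + 1))"
  have pos: "norm R + 1 > 0" by (simp add: add_nonneg_pos)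
  obtain d where d: "d > 0"
    "\<And>x. norm x \<le> 1 \<Longrightarrow> norm (f x) > 1 - d \<Longrightarrow> \<exists>c. norm c = 1 \<and> norm (x - sX c x\<^sub>0) < ?e"
    using exposing[of ?e] pos by auto
  \<comment> \<open>Where \<open>norm (f x)\<close> is at most \<open>1 - d\<close>, the gap
    \<open>d\<close> pays for the whole perturbation \<open>t * norm (R x)\<close>.\<close>
  define t where "t = d / (norm R + 1)"
  have t: "t > 0" "t * (norm R + 1) = d"
    using d(1) pos by (simp_all add: t_def)
  let ?T = "rank_one y + scale_op sY (of_real t) R"
  have bound: "norm (?T x) \<le> norm (f x) + t * norm (R x)" for x
    using norm_triangle_ineq[of "sY (f x) y" "sY (of_real t) (R x)"] y t
    by (simp add: blinfun.add_left Y.norm_scale)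
  have "norm ?T \<le> 1 + t / 2"
  proof (rule norm_blinfun_le_unit)
    fix x :: 'a assume x: "norm x \<le> 1"
    show "norm (?T x) \<le> 1 + t / 2"
    proof (cases "norm (f x) > 1 - d")
      case True
      then obtain c where c: "norm c = 1" "norm (x - sX c x\<^sub>0) < ?e"
        using d(2) x by blast
      have "R x = R (x - sX c x\<^sub>0)"
        using R by (simp add: blinfun.diff_right Ops_iff)
      then have "norm (R x) \<le> norm R * norm (x - sX c x\<^sub>0)"
        by (simp only: norm_blinfun)
      also have "\<dots> \<le> norm R * ?e"
        using c by (intro mult_left_mono) auto
      also have "\<dots> \<le> 1 / 2"
        using pos by (simp add: field_simps)
      finally have "t * norm (R x) \<le> t * (1 / 2)"
        using t by (intro mult_left_mono) auto
      with bound[of x] norm_f_le[of x] x show ?thesis by simp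
    next
      case False
      have "norm (R x) \<le> norm R * 1"
        using norm_blinfun[of R x] x by (meson mult_left_mono norm_ge_zero order_trans)
      then have "t * norm (R x) \<le> t * (norm R + 1)"
        using t by (intro mult_left_mono) auto
      with bound[of x] False t show ?thesis by simp
    qed
  qed (use t in simp)
  moreover have tR: "scale_op sY (of_real t) R \<in> Ops"
    using R subspace_Ops by (auto simp: L.subspace_def)
  moreover from this have "norm (\<phi> ?T) \<le> norm ?T"
    using subspace_Ops by (intro \<phi>_le) (auto simp: L.subspace_def)
  moreover have "\<phi> ?T = of_real (1 + t)"
    using R tR by (simp add: \<phi>_add \<phi>_scale \<phi>_1)
  ultimately show False
    using t by (simp del: of_real_add)
qed

text \<open>The operators \<open>S\<close> and \<open>rank_one (S x\<^sub>0)\<close> agree at the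
  exposed point, so \<open>support_functional_vanishes\<close> kills their difference. Every support
  functional thus factors through evaluation at that point.\<close>

lemma support_functional_rank_one:
  assumes y: "norm y = 1" and \<phi>: "\<phi> \<in> support_functionals (scale_op sY) Ops (rank_one y)"
  shows "(\<lambda>v. \<phi> (rank_one v)) \<in> support_functionals sY UNIV y"
    and "\<And>S. S \<in> Ops \<Longrightarrow> \<phi> S = \<phi> (rank_one (S x\<^sub>0))"
proof -
  note iff = L.support_functionals_iff[OF subspace_Ops]
  have R: "rank_one y \<in> Ops" "norm (rank_one y) = 1"
    using y by simp_all
  have \<phi>_le: "norm (\<phi> (rank_one v)) \<le> norm v" for v
    using \<phi> unfolding iff[OF R] by (metis norm_rank_one rank_one_Ops)
  show "(\<lambda>v. \<phi> (rank_one v)) \<in> support_functionals sY UNIV y"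
    using \<phi> y \<phi>_le unfolding iff[OF R] Y.support_functionals_iff[OF Y.subspace_UNIV UNIV_I y]
    by (simp add: rank_one_add rank_one_scale)
  fix S assume S: "S \<in> Ops"
  define D where "D = S - rank_one (S x\<^sub>0)"
  have D: "D \<in> Ops"
    unfolding D_def by (rule L.subspace_diff[OF subspace_Ops S]) simp
  moreover have "D x\<^sub>0 = 0"
    by (simp add: D_def blinfun.diff_left)
  ultimately have "\<phi> D = 0"
    by (rule support_functional_vanishes[OF y \<phi>])
  moreover have "\<phi> (D + rank_one (S x\<^sub>0)) = \<phi> D + \<phi> (rank_one (S x\<^sub>0))"
    using \<phi> D unfolding iff[OF R] by simp
  ultimately show "\<phi> S = \<phi> (rank_one (S x\<^sub>0))"
    by (simp add: D_def)
qed

text \<open>Composing the support functional of \<open>y\<close> with evaluation at the exposed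
  point gives existence. The factorization of all support functionals, with smoothness of
  \<open>y\<close>, gives uniqueness.\<close>

lemma smooth_rank_one:
  assumes y: "norm y = 1" and smooth: "smooth_point sY UNIV y"
  shows "smooth_operator sX sY (rank_one y)"
proof -
  note iff = L.support_functionals_iff[OF subspace_Ops]
  have R: "rank_one y \<in> Ops" "norm (rank_one y) = 1"
    using y by simp_all
  obtain \<psi> where \<psi>: "support_functionals sY UNIV y = {\<psi>}"
    using smooth by (rule Y.smooth_pointE)
  then have "\<psi> \<in> support_functionals sY UNIV y" by simp
  then have \<psi>_simps: "\<psi> (v + w) = \<psi> v + \<psi> w" "\<psi> (sY c v) = c * \<psi> v" "\<psi> y = 1"
      "norm (\<psi> v) \<le> norm v" for v w c
    using y by (auto simp: Y.support_functionals_iff)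
  have "norm (\<psi> (S x\<^sub>0)) \<le> norm S" for S :: "'a \<Rightarrow>\<^sub>L 'b"
    using \<psi>_simps(4) norm_apply_x0 order_trans by blast
  moreover have "S + T \<in> Ops" "scale_op sY c S \<in> Ops" if "S \<in> Ops" "T \<in> Ops" for S T c
    using subspace_Ops that by (auto simp: L.subspace_def)
  \<comment> \<open>The restriction supplies the extensionality demanded by
    \<open>dual\<close>.\<close>
  moreover define \<phi>\<^sub>0 where "\<phi>\<^sub>0 = restrict (\<lambda>S :: 'a \<Rightarrow>\<^sub>L 'b. \<psi> (S x\<^sub>0)) Ops"
  ultimately have "\<phi>\<^sub>0 \<in> support_functionals (scale_op sY) Ops (rank_one y)"
    unfolding iff[OF R] by (simp add: \<psi>_simps blinfun.add_left)
  moreover have "\<phi> = \<phi>\<^sub>0"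
    if \<phi>: "\<phi> \<in> support_functionals (scale_op sY) Ops (rank_one y)" for \<phi>
  proof
    fix S
    have "(\<lambda>v. \<phi> (rank_one v)) = \<psi>"
      using support_functional_rank_one(1)[OF y \<phi>] \<psi> by simp
    then show "\<phi> S = \<phi>\<^sub>0 S"
      using support_functional_rank_one(2)[OF y \<phi>, of S] \<phi> unfolding iff[OF R]
      by (auto simp: \<phi>\<^sub>0_def extensional_def fun_eq_iff)
  qed
  ultimately have "support_functionals (scale_op sY) Ops (rank_one y) = {\<phi>\<^sub>0}"
    by blast
  then show ?thesis
    unfolding smooth_point_def support_functionals_def[symmetric] by simp
qed

text \<open>\<open>rank_one y\<close> attains its norm at the unit vector \<open>x\<^sub>0\<close>,
  so evaluation there bounds the perturbed operator from below.\<close>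

lemma bj_orthogonal_rank_one:
  fixes A :: "'a \<Rightarrow>\<^sub>L 'b"
  assumes "bj_orthogonal sY y (A x\<^sub>0)"
  shows "bj_orthogonal (scale_op sY) (rank_one y) A"
  unfolding bj_orthogonal_def
proof
  fix c
  have "norm (rank_one y) \<le> norm (y + sY c (A x\<^sub>0))"
    using assms by (simp add: bj_orthogonal_def)
  also have "\<dots> \<le> norm (rank_one y + scale_op sY c A)"
    using norm_apply_x0[of "rank_one y + scale_op sY c A"] by (simp add: blinfun.add_left)
  finally show "norm (rank_one y) \<le> norm (rank_one y + scale_op sY c A)" .
qed

section \<open>Absence of spear operators\<close>

lemma no_spear_operator:
  assumes smooth: "smooth_space sY UNIV" and B: "card B = 2" "\<not> Y.dependent B"
  shows "\<not> spear_operator sX sY U"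
proof
  assume spear: "spear_operator sX sY U"
  then have U: "U \<in> Ops" "norm U = 1"
    by (auto simp: spear_vector_def)
  define w where "w = U x\<^sub>0"
  have unit: "\<exists>\<eta> \<in> support_functionals sY UNIV y. norm (\<eta> w) = 1" if y: "norm y = 1" for y
  proof -
    obtain \<phi> where \<phi>: "\<phi> \<in> support_functionals (scale_op sY) Ops U"
      "norm (\<phi> (rank_one y)) = norm (rank_one y)"
      using L.spear_vector_attained[OF subspace_Ops spear rank_one_Ops] .
    \<comment> \<open>Rescaling turns a functional supporting \<open>U\<close> into one supporting
      \<open>rank_one y\<close>, hence one that factors through evaluation at
      \<open>x\<^sub>0\<close>; its modulus at \<open>U\<close> stays 1.\<close>
    define \<phi>' where "\<phi>' = (\<lambda>S\<in>Ops. \<phi> S / \<phi> (rank_one y))"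
    have \<phi>': "\<phi>' \<in> support_functionals (scale_op sY) Ops (rank_one y)"
      unfolding \<phi>'_def
      by (rule L.support_functionals_rescale[OF subspace_Ops U _ _ \<phi>(1)]) (use \<phi>(2) y in simp_all)
    have "\<phi> U = 1"
      using \<phi>(1) U by (simp add: support_functionals_def)
    then have "norm (\<phi>' U) = 1"
      using \<phi>(2) U y by (simp add: \<phi>'_def norm_divide)
    then have "norm (\<phi>' (rank_one w)) = 1"
      using support_functional_rank_one(2)[OF y \<phi>' U(1)] by (simp add: w_def)
    then show ?thesis
      using support_functional_rank_one(1)[OF y \<phi>'] by (intro bexI) auto
  qed
  have le: "norm (\<eta> v) \<le> norm v" if "\<eta> \<in> support_functionals sY UNIV y" "norm y = 1" for \<eta> v y
    using that by (simp add: Y.support_functionals_iff)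
  obtain v where v: "\<And>c. v \<noteq> sY c w"
    using Y.ex_not_multiple[OF B] by metis
  then have "v \<noteq> 0" by (metis Y.scale_zero_left)
  then obtain \<eta>\<^sub>0 where "\<eta>\<^sub>0 \<in> support_functionals sY UNIV (sY (of_real (inverse (norm v))) v)"
      "norm (\<eta>\<^sub>0 w) = 1"
    using unit Y.norm_normalize by blast
  \<comment> \<open>A functional bounded by the norm is unimodular at \<open>w\<close>, so
    \<open>w\<close> has norm at least 1; \<open>norm U = 1\<close> gives the other
    inequality.\<close>
  then have w: "norm w = 1"
    using le[of \<eta>\<^sub>0 _ w] Y.norm_normalize[OF \<open>v \<noteq> 0\<close>] norm_apply_x0[of U] U by (simp add: w_def)
  then have "smooth_point sY UNIV w"
    using smooth unfolding smooth_space_def by force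
  then obtain \<psi> where \<psi>: "support_functionals sY UNIV w = {\<psi>}"
    by (rule Y.smooth_pointE)
  then have "\<psi> \<in> support_functionals sY UNIV w" by simp
  then have \<psi>_simps: "\<psi> (a + b) = \<psi> a + \<psi> b" "\<psi> (sY c a) = c * \<psi> a" "\<psi> w = 1" for a b c
    using w by (auto simp: Y.support_functionals_iff)
  \<comment> \<open>This is the part of \<open>v\<close> in the kernel of \<open>\<psi>\<close>; it
    is nonzero because \<open>v\<close> is not a multiple of \<open>w\<close>.\<close>
  define z where "z = v + sY (- \<psi> v) w"
  have "z \<noteq> 0"
    using v[of "\<psi> v"] by (simp add: z_def)
  define y where "y = sY (of_real (inverse (norm z))) z"
  have "\<psi> z = 0"
    unfolding z_def \<psi>_simps by simp
  then have y: "norm y = 1" "\<psi> y = 0"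
    using Y.norm_normalize[OF \<open>z \<noteq> 0\<close>] unfolding y_def \<psi>_simps(2) by simp_all
  obtain \<eta> where \<eta>: "\<eta> \<in> support_functionals sY UNIV y" "norm (\<eta> w) = 1"
    using unit[OF y(1)] by blast
  have "(\<lambda>x\<in>UNIV. \<eta> x / \<eta> w) \<in> support_functionals sY UNIV w"
    by (rule Y.support_functionals_rescale[OF Y.subspace_UNIV _ y(1) _ w \<eta>]) simp_all
  \<comment> \<open>Smoothness at \<open>w\<close> identifies the rescaled functional with
    \<open>\<psi>\<close>, which vanishes at \<open>y\<close>, although
    \<open>\<eta> y = 1\<close>.\<close>
  then have "(\<lambda>x. \<eta> x / \<eta> w) = \<psi>"
    using \<psi> by (simp add: restrict_UNIV)
  then have "\<eta> y / \<eta> w = \<psi> y" by (rule fun_cong)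
  moreover have "\<eta> y = 1"
    using \<eta>(1) y(1) by (simp add: support_functionals_def)
  ultimately show False
    using y(2) \<eta>(2) by auto
qed

end

theorem corollary5p9:
  fixes sX :: "'k::real_or_complex \<Rightarrow> 'a::banach \<Rightarrow> 'a"
    and sY :: "'k \<Rightarrow> 'b::banach \<Rightarrow> 'b"
  assumes "normed_space_over sX" and "normed_space_over sY"
    and "strongly_exposed_points sX \<noteq> {}"
    and "smooth_space sY UNIV"
    and "\<exists>B. card B = 2 \<and> \<not> module.dependent sY B"
  shows "(\<forall>A \<in> operators sX sY. \<exists>T \<in> operators sX sY.
      smooth_operator sX sY T \<and> bj_orthogonal (scale_op sY) T A) \<and>
    (\<nexists>U. spear_operator sX sY U)"
proof -
  interpret X: normed_space_over sX by fact
  interpret Y: normed_space_over sY by fact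
  obtain x\<^sub>0 where "x\<^sub>0 \<in> strongly_exposed_points sX"
    using assms(3) by blast
  then obtain f where f: "norm x\<^sub>0 = 1" "f \<in> support_functionals sX UNIV x\<^sub>0"
    "\<And>e. e > 0 \<Longrightarrow> \<exists>d>0. \<forall>x. norm x \<le> 1 \<and> norm (f x) > 1 - d \<longrightarrow>
      (\<exists>c. norm c = 1 \<and> norm (x - sX c x\<^sub>0) < e)"
    by (rule X.strongly_exposedE) blast
  interpret strongly_exposed_operators sX sY x\<^sub>0 f
    by (intro strongly_exposed_operators.intro strongly_exposed_operators_axioms.intro assms f)
  obtain B where B: "card B = 2" "\<not> Y.dependent B"
    using assms(5) by blast
  have "\<exists>T \<in> Ops. smooth_operator sX sY T \<and> bj_orthogonal (scale_op sY) T A" for A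
  proof -
    obtain v where v: "\<And>c. v \<noteq> sY c (A x\<^sub>0)"
      using Y.ex_not_multiple[OF B] by metis
    obtain y where y: "norm y = 1" "bj_orthogonal sY y (A x\<^sub>0)"
      using Y.ex_bj_orthogonal[OF v] .
    then have "smooth_point sY UNIV y"
      using assms(4) unfolding smooth_space_def by force
    with y show ?thesis
      using smooth_rank_one bj_orthogonal_rank_one rank_one_Ops by blast
  qed
  then show ?thesis
    using no_spear_operator[OF assms(4) B] by blast
qed

end
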